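(* There exists $N$ such that the following holds for all $n\ge N$. Let $n,k,r$ be positive integers with $1\le r\le\min\{k,n-k\}$ satisfying at least one of the following two conditions: (i) $r(n-1)=k(n-k)$ and $r\ge\frac n4$; (ii) $n=4r$ with $r\ge5$, and $k=2r-a$ or $k=2r+a$ for some integer $a$ with $2\le a\le\sqrt r$. Then $$\chi_Q(J(n,k,k-r))<\chi(J(n,k,k-r)).$$
   Context: For integers $0\le s\le k\le n$, the generalized Johnson graph $J(n,k,s)$ has as vertices all $k$-element subsets of $[n]=\{1,\dots,n\}$, and two distinct vertices $A,B$ are adjacent if and only if $|A\cap B|=s$. $\chi(G)$ denotes the (classical) chromatic number of $G$. Quantum chromatic number: let $G$ be a finite simple graph and $c$ a positive integer. A quantum $c$-coloring of $G$ consists of a positive integer $m$ and Hermitian projectors $\mathbf{P}_{v,\alpha}\in\mathbb{C}^{m\times m}$ ($v\in V(G)$, $\alpha\in\{1,\dots,c\}$), i.e. $\mathbf{P}_{v,\alpha}^*=\mathbf{P}_{v,\alpha}=\mathbf{P}_{v,\alpha}^2$, such that (1) for every vertex $v$, $\mathbf{P}_{v,\alpha}\mathbf{P}_{v,\beta}=\mathbf{O}$ for $\alpha\ne\beta$ and $\sum_{\alpha=1}^c\mathbf{P}_{v,\alpha}=\mathbf{I}_m$; (2) for every edge $uv$ and every color $\alpha$, $\mathbf{P}_{u,\alpha}\mathbf{P}_{v,\alpha}=\mathbf{O}$. The quantum chromatic number $\chi_Q(G)$ is the least $c$ for which a quantum $c$-coloring of $G$ exists. *)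

theory Defs
  imports
    "Jordan_Normal_Form.Schur_Decomposition"
    "Graph_Theory.Pair_Digraph"
begin

text \<open>
  A finite simple graph is represented as a symmetric loop-free digraph on a finite vertex set
  (locale \<^locale>\<open>pair_graph\<close>): every undirected edge is a pair of opposite arcs.
\<close>

definition gen_johnson_graph :: "nat \<Rightarrow> nat \<Rightarrow> nat \<Rightarrow> nat set pair_pre_digraph" where
  "gen_johnson_graph n k s =
    (let V = {A. A \<subseteq> {1..n} \<and> card A = k}
     in \<lparr> pverts = V,
          parcs = {(A, B). A \<in> V \<and> B \<in> V \<and> A \<noteq> B \<and> card (A \<inter> B) = s} \<rparr>)"

lemma pair_graph_gen_johnson_graph: "pair_graph (gen_johnson_graph n k s)"
proof -
  define V where "V = {A. A \<subseteq> {1..n} \<and> card A = k}"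
  define E where "E = {(A, B). A \<in> V \<and> B \<in> V \<and> A \<noteq> B \<and> card (A \<inter> B) = s}"
  have G: "gen_johnson_graph n k s = \<lparr> pverts = V, parcs = E \<rparr>"
    unfolding gen_johnson_graph_def Let_def V_def[symmetric] E_def ..
  have fin: "finite V"
    unfolding V_def by (rule finite_subset[of _ "Pow {1..n}"]) auto
  have E: "E \<subseteq> V \<times> V" "(A, B) \<in> E \<Longrightarrow> A \<noteq> B" for A B
    unfolding E_def by auto
  have finE: "finite E"
    using E(1) finite_cartesian_product[OF fin fin] by (rule finite_subset)
  have symE: "sym E"
    unfolding sym_def
  proof (intro allI impI)
    fix A B assume "(A, B) \<in> E"
    then show "(B, A) \<in> E"
      using Int_commute[of A B] unfolding E_def by auto
  qed
  show ?thesis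
    unfolding G
  proof unfold_locales
    show "symmetric (with_proj \<lparr>pverts = V, parcs = E\<rparr>)"
      using symE by (simp add: symmetric_def)
  qed (use E(1) fin finE in \<open>auto dest: E(2)\<close>)
qed

definition proper_coloring :: "'a pair_pre_digraph \<Rightarrow> nat \<Rightarrow> ('a \<Rightarrow> nat) \<Rightarrow> bool" where
  "proper_coloring G c f \<longleftrightarrow>
    f \<in> pverts G \<rightarrow> {1..c} \<and> (\<forall>(u, v) \<in> parcs G. f u \<noteq> f v)"

definition chromatic_number :: "'a pair_pre_digraph \<Rightarrow> nat" where
  "chromatic_number G = (LEAST c. \<exists>f. proper_coloring G c f)"

definition hermitian_projector :: "nat \<Rightarrow> complex mat \<Rightarrow> bool" where
  "hermitian_projector m P \<longleftrightarrow> P \<in> carrier_mat m m \<and> mat_adjoint P = P \<and> P * P = P"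

definition quantum_coloring ::
    "'a pair_pre_digraph \<Rightarrow> nat \<Rightarrow> nat \<Rightarrow> ('a \<Rightarrow> nat \<Rightarrow> complex mat) \<Rightarrow> bool" where
  "quantum_coloring G c m P \<longleftrightarrow>
    m > 0 \<and>
    (\<forall>v \<in> pverts G. \<forall>\<alpha> \<in> {1..c}. hermitian_projector m (P v \<alpha>)) \<and>
    (\<forall>v \<in> pverts G. \<forall>\<alpha> \<in> {1..c}. \<forall>\<beta> \<in> {1..c}. \<alpha> \<noteq> \<beta> \<longrightarrow> P v \<alpha> * P v \<beta> = 0\<^sub>m m m) \<and>
    (\<forall>v \<in> pverts G. finsum (ring_mat TYPE(complex) m ()) (P v) {1..c} = 1\<^sub>m m) \<and>
    (\<forall>(u, v) \<in> parcs G. \<forall>\<alpha> \<in> {1..c}. P u \<alpha> * P v \<alpha> = 0\<^sub>m m m)"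

definition quantum_chromatic_number :: "'a pair_pre_digraph \<Rightarrow> nat" where
  "quantum_chromatic_number G = (LEAST c. c > 0 \<and> (\<exists>m P. quantum_coloring G c m P))"

text \<open>
  The following facts show that the matrix sum is the entrywise one, that \<^const>\<open>mat_adjoint\<close>
  is the conjugate transpose, and that both minima are attained for finite simple graphs.
\<close>

lemma finsum_ring_mat:
  assumes "finite A" "\<And>x. x \<in> A \<Longrightarrow> F x \<in> carrier_mat m m"
  shows "finsum (ring_mat TYPE('a :: comm_ring_1) m b) F A = mat m m (\<lambda>ij. \<Sum>x\<in>A. F x $$ ij)"
  using assms
proof (induction A rule: finite_induct)
  case empty
  interpret ring "ring_mat TYPE('a) m b" by (rule ring_mat)
  show ?case by (auto simp: ring_mat_simps)
next
  case (insert x A)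
  interpret ring "ring_mat TYPE('a) m b" by (rule ring_mat)
  have "finsum (ring_mat TYPE('a) m b) F (insert x A)
      = F x + finsum (ring_mat TYPE('a) m b) F A"
    using insert.hyps insert.prems by (subst finsum_insert) (auto simp: ring_mat_simps)
  then show ?case
    using insert by auto
qed

lemma mat_adjoint_entrywise:
  "mat_adjoint A = mat (dim_col A) (dim_row A) (\<lambda>(i, j). cnj (A $$ (j, i)))"
  by (rule eq_matI) (auto simp: mat_adjoint_def mat_of_rows_def)

lemma quantum_coloring_of_proper_coloring:
  assumes "proper_coloring G c f"
    and "parcs G \<subseteq> pverts G \<times> pverts G"
  shows "quantum_coloring G c 1 (\<lambda>v \<alpha>. if f v = \<alpha> then 1\<^sub>m 1 else 0\<^sub>m 1 1)"
proof -
  have f: "f v \<in> {1..c}" if "v \<in> pverts G" for v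
    using assms(1) that by (auto simp: proper_coloring_def)
  have E: "f u \<noteq> f v" if "(u, v) \<in> parcs G" for u v
    using assms(1) that by (auto simp: proper_coloring_def)
  have proj: "hermitian_projector 1 (if b then 1\<^sub>m 1 else 0\<^sub>m 1 1)" for b
    unfolding hermitian_projector_def mat_adjoint_entrywise by auto
  have sum: "finsum (ring_mat TYPE(complex) 1 ())
      (\<lambda>\<alpha>. if f v = \<alpha> then 1\<^sub>m 1 else 0\<^sub>m 1 1) {1..c} = 1\<^sub>m 1" if "v \<in> pverts G" for v
  proof -
    have "(\<Sum>\<alpha>\<in>{1..c}. (if f v = \<alpha> then 1\<^sub>m 1 else 0\<^sub>m 1 1) $$ (0, 0))
        = (\<Sum>\<alpha>\<in>{1..c}. if f v = \<alpha> then 1 else (0 :: complex))"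
      by (rule sum.cong) auto
    also have "\<dots> = 1"
      using f[OF that] by simp
    finally show ?thesis
      by (subst finsum_ring_mat) auto
  qed
  show ?thesis
    unfolding quantum_coloring_def
    using sum proj by (auto simp del: One_nat_def dest: E)
qed

lemma proper_coloring_exists:
  assumes "pair_graph G"
  shows "\<exists>c f. c > 0 \<and> proper_coloring G c f"
proof -
  interpret pair_graph G by fact
  obtain h where h: "bij_betw h (pverts G) {1..card (pverts G)}"
    using finite_same_card_bij[OF pair_finite_verts, of "{1..card (pverts G)}"] by auto
  have "proper_coloring G (Suc (card (pverts G))) h"
    unfolding proper_coloring_def
  proof (intro conjI)
    show "h \<in> pverts G \<rightarrow> {1..Suc (card (pverts G))}"
      using bij_betwE[OF h] by fastforce
    show "\<forall>(u, v)\<in>parcs G. h u \<noteq> h v"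
      using bij_betw_imp_inj_on[OF h] in_arcsD1 in_arcsD2 pair_no_loops
      by (fastforce dest: inj_onD)
  qed
  then show ?thesis by blast
qed

lemma chromatic_number_attained:
  assumes "pair_graph G"
  shows "\<exists>f. proper_coloring G (chromatic_number G) f"
  unfolding chromatic_number_def
  by (rule LeastI_ex) (use proper_coloring_exists[OF assms] in blast)

lemma quantum_chromatic_number_attained:
  assumes "pair_graph G"
  shows "quantum_chromatic_number G > 0 \<and>
    (\<exists>m P. quantum_coloring G (quantum_chromatic_number G) m P)"
proof -
  interpret pair_graph G by fact
  have arcs: "parcs G \<subseteq> pverts G \<times> pverts G"
    using in_arcsD1 in_arcsD2 by auto
  obtain c f where "c > 0" "proper_coloring G c f"
    using proper_coloring_exists[OF assms] by blast
  then have "\<exists>c. c > 0 \<and> (\<exists>m P. quantum_coloring G c m P)"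
    using quantum_coloring_of_proper_coloring[OF _ arcs] by blast
  then show ?thesis
    unfolding quantum_chromatic_number_def by (rule LeastI_ex)
qed

end

theory Submission
  imports Defs "HOL-Number_Theory.Cong" "HOL-Real_Asymp.Real_Asymp"
begin

text \<open>
  For the quantum upper bound, send \<open>A\<close> to the vector with entry \<open>z\<close> on \<open>A\<close> and \<open>1\<close> off \<open>A\<close>, where
  \<open>z\<close> is unimodular with real part \<open>1 - n / (2 r)\<close>; this exists because \<open>n \<le> 4 r\<close>. Adjacent sets
  get orthogonal vectors, and twisting each vector by the characters of the cyclic group of order \<open>n\<close>
  gives a quantum \<open>n\<close>-coloring.

  For the classical lower bound, both conditions force \<open>4 r - 1 \<le> n \<le> 4 r\<close> and
  \<open>(k - 2 r)\<^sup>2 \<le> r\<close>. For a prime power \<open>q\<close>, a family of \<open>(2 q - 1)\<close>-sets without intersections of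
  size \<open>q - 1\<close> is small (Frankl and Wilson). To pass from prime powers to all \<open>r\<close>, write
  \<open>r = q m + 3 m'\<close> with \<open>q\<close> a power of \<open>2\<close> near the eighth root of \<open>r\<close>, and build \<open>k\<close>-sets from a
  \<open>(2 q - 1)\<close>-set \<open>A\<close> blown up \<open>m\<close> times and a \<open>5\<close>-set \<open>X\<close> blown up \<open>m'\<close> times. Given an
  \<open>n\<close>-coloring, every \<open>A\<close> has a monochromatic pair \<open>X, Y\<close> meeting in two points; coloring \<open>A\<close> by this
  pair and its color uses only polynomially many colors in \<open>q\<close>, whereas avoiding intersections of
  size \<open>q - 1\<close> needs exponentially many.
\<close>

section \<open>Binomial coefficients modulo a prime\<close>

text \<open>If \<open>p\<close> did not divide the coefficient, the absorption identity would force
  \<open>p ^ e\<close> to divide the smaller positive number \<open>k\<close>.\<close>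

lemma prime_dvd_prime_power_choose:
  fixes p :: nat
  assumes "prime p" "0 < k" "k < p ^ e"
  shows "p dvd p ^ e choose k"
proof (rule ccontr)
  assume "\<not> ?thesis"
  then have "coprime (p ^ e) (p ^ e choose k)"
    using assms(1) by (simp add: prime_imp_coprime)
  moreover have "k * (p ^ e choose k) = p ^ e * (p ^ e - 1 choose (k - 1))"
    using assms by (intro times_binomial_minus1_eq) auto
  ultimately have "p ^ e dvd k"
    by (metis coprime_dvd_mult_left_iff dvd_triv_left)
  then show False
    using assms by (auto dest: dvd_imp_le)
qed

text \<open>In the Vandermonde expansion every term except \<open>k = 0\<close> vanishes modulo
  \<open>p\<close>. Lower index \<open>j\<close> therefore gives period
  \<open>p ^ e\<close>.\<close>

lemma cong_choose_add_prime_power: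
  fixes p :: nat
  assumes "prime p" "j < p ^ e"
  shows "[(p ^ e + x) choose j = x choose j] (mod p)"
proof -
  have "(p ^ e + x) choose j = (\<Sum>k\<le>j. (p ^ e choose k) * (x choose (j - k)))"
    by (rule vandermonde[symmetric])
  also have "\<dots> = (x choose j) + (\<Sum>k\<in>{0<..j}. (p ^ e choose k) * (x choose (j - k)))"
  proof -
    have "{..j} = insert 0 {0<..j}" by auto
    then show ?thesis by simp
  qed
  also have "[\<dots> = (x choose j) + 0] (mod p)"
  proof (intro cong_add cong_refl)
    show "[(\<Sum>k\<in>{0<..j}. (p ^ e choose k) * (x choose (j - k))) = 0] (mod p)"
      unfolding cong_0_iff
      by (rule dvd_sum) (use assms in \<open>auto intro!: dvd_mult2 prime_dvd_prime_power_choose\<close>)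
  qed
  finally show ?thesis by simp
qed

text \<open>Here \<open>x\<close> plays the size of the intersection of two distinct sets. Below
  \<open>p ^ e - 1\<close> the coefficient is zero; from \<open>p ^ e\<close> on, removing one
  period leaves an upper index below \<open>p ^ e - 1\<close>.\<close>

lemma prime_dvd_choose_prime_power_minus_1:
  fixes p :: nat
  assumes "prime p" "x < 2 * p ^ e - 1" "x \<noteq> p ^ e - 1"
  shows "p dvd x choose (p ^ e - 1)"
proof (cases "x < p ^ e")
  case True
  then show ?thesis using assms by (simp add: binomial_eq_0)
next
  case False
  then obtain y where y: "x = p ^ e + y" by (metis le_add_diff_inverse not_less)
  have "0 < p ^ e" using assms(1) by (simp add: prime_gt_0_nat)
  then have "[x choose (p ^ e - 1) = y choose (p ^ e - 1)] (mod p)"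
    unfolding y using assms(1) by (intro cong_choose_add_prime_power) auto
  moreover have "y choose (p ^ e - 1) = 0"
    using assms y by (intro binomial_eq_0) auto
  ultimately show ?thesis by (metis cong_0_iff)
qed

text \<open>The diagonal counterpart: removing one period leaves a coefficient equal to 1.\<close>

lemma prime_not_dvd_choose_prime_power_minus_1:
  fixes p :: nat
  assumes "prime p"
  shows "\<not> p dvd (2 * p ^ e - 1) choose (p ^ e - 1)"
proof -
  have pos: "0 < p ^ e" using assms by (simp add: prime_gt_0_nat)
  then have eq: "2 * p ^ e - 1 = p ^ e + (p ^ e - 1)" by simp
  have "[(2 * p ^ e - 1) choose (p ^ e - 1) = (p ^ e - 1) choose (p ^ e - 1)] (mod p)"
    unfolding eq using assms pos by (intro cong_choose_add_prime_power) auto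
  then have "[(2 * p ^ e - 1) choose (p ^ e - 1) = 1] (mod p)" by simp
  then show ?thesis
    using assms by (metis cong_dvd_iff not_prime_unit)
qed

section \<open>Families with a forbidden intersection size\<close>

text \<open>Each nonzero product marks a \<open>t\<close>-subset of \<open>A \<inter> B\<close>. The
  identity factors the matrix of these coefficients through the \<open>t\<close>-subsets of
  \<open>V\<close>, which bounds its rank.\<close>

lemma sum_subset_indicators:
  assumes "finite V" "A \<subseteq> V"
  shows "(\<Sum>S | S \<subseteq> V \<and> card S = t. of_bool (S \<subseteq> A) * of_bool (S \<subseteq> B) :: int)
    = int (card (A \<inter> B) choose t)"
proof -
  have fin: "finite {S. S \<subseteq> V \<and> card S = t}"
    by (rule finite_subset[of _ "Pow V"]) (use assms in auto)
  have "(\<Sum>S | S \<subseteq> V \<and> card S = t. of_bool (S \<subseteq> A) * of_bool (S \<subseteq> B) :: int)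
      = (\<Sum>S | S \<subseteq> V \<and> card S = t. if S \<subseteq> A \<inter> B then 1 else 0)"
    by (rule sum.cong) auto
  also have "\<dots> = int (card ({S. S \<subseteq> V \<and> card S = t} \<inter> {S. S \<subseteq> A \<inter> B}))"
    using fin by (simp add: sum.If_cases)
  also have "{S. S \<subseteq> V \<and> card S = t} \<inter> {S. S \<subseteq> A \<inter> B} = {S. S \<subseteq> A \<inter> B \<and> card S = t}"
    using assms by auto
  also have "card \<dots> = card (A \<inter> B) choose t"
    using assms by (intro n_subsets) (auto intro: finite_subset)
  finally show ?thesis .
qed

text \<open>Pigeonhole in place of linear algebra: there are \<open>p ^ card F\<close> coefficient
  vectors but at most \<open>p ^ card T\<close> value vectors modulo \<open>p\<close>, so two
  coefficient vectors collide, and \<open>d\<close> is their difference.\<close>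

lemma nontrivial_relation_mod:
  fixes w :: "'a \<Rightarrow> 'b \<Rightarrow> int"
  assumes "finite F" "finite T" "card T < card F" "1 < p"
  obtains d where "\<And>S. S \<in> T \<Longrightarrow> int p dvd (\<Sum>A\<in>F. d A * w A S)"
    and "\<exists>A\<in>F. \<not> int p dvd d A"
proof -
  define D where "D = (F \<rightarrow>\<^sub>E {0..<int p})"
  define R where "R = (T \<rightarrow>\<^sub>E {0..<int p})"
  define \<phi> where "\<phi> = (\<lambda>c. restrict (\<lambda>S. (\<Sum>A\<in>F. c A * w A S) mod int p) T)"
  have "\<phi> ` D \<subseteq> R"
    using assms(4) by (auto simp: \<phi>_def R_def)
  moreover have "finite R"
    unfolding R_def using assms(2) by (intro finite_PiE) auto
  ultimately have "card (\<phi> ` D) \<le> card R"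
    by (rule card_mono[rotated])
  also have "\<dots> < card D"
    using assms by (simp add: D_def R_def card_PiE)
  finally have "\<not> inj_on \<phi> D"
    using card_image[of \<phi> D] by auto
  then obtain c c' where c: "c \<in> D" "c' \<in> D" "\<phi> c = \<phi> c'" "c \<noteq> c'"
    unfolding inj_on_def by blast
  show thesis
  proof (rule that[of "\<lambda>A. c A - c' A"])
    fix S assume "S \<in> T"
    then have "(\<Sum>A\<in>F. c A * w A S) mod int p = (\<Sum>A\<in>F. c' A * w A S) mod int p"
      using fun_cong[OF c(3), of S] by (simp add: \<phi>_def)
    then show "int p dvd (\<Sum>A\<in>F. (c A - c' A) * w A S)"
      by (simp add: mod_eq_dvd_iff left_diff_distrib sum_subtractf)
  next
    from c obtain A where A: "A \<in> F" "c A \<noteq> c' A"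
      unfolding D_def by (meson PiE_ext)
    then have "c A mod int p = c A" "c' A mod int p = c' A"
      using c by (auto simp: D_def PiE_iff)
    then have "\<not> int p dvd c A - c' A"
      using A by (metis mod_eq_dvd_iff)
    then show "\<exists>A\<in>F. \<not> int p dvd c A - c' A"
      using A by blast
  qed
qed

text \<open>A larger family would have inclusion vectors dependent modulo \<open>p\<close>. Pairing
  the relation with the vector of a set \<open>B\<close> whose coefficient is nonzero modulo
  \<open>p\<close> kills all terms \<open>A \<noteq> B\<close>, while the term of \<open>B\<close>
  survives.\<close>

lemma frankl_wilson:
  fixes p :: nat
  assumes "prime p" "finite V"
    and F: "F \<subseteq> {A. A \<subseteq> V \<and> card A = 2 * p ^ e - 1}"
    and avoid: "\<And>A B. A \<in> F \<Longrightarrow> B \<in> F \<Longrightarrow> card (A \<inter> B) \<noteq> p ^ e - 1"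
  shows "card F \<le> card V choose (p ^ e - 1)"
proof (rule ccontr)
  assume less: "\<not> ?thesis"
  define T where "T = {S. S \<subseteq> V \<and> card S = p ^ e - 1}"
  define w :: "'a set \<Rightarrow> 'a set \<Rightarrow> int" where "w A S = of_bool (S \<subseteq> A)" for A S
  have fin: "finite F" "finite T"
    using F assms(2) by (auto simp: T_def intro: finite_subset[of _ "Pow V"])
  have "card T < card F"
    using less assms(2) by (simp add: T_def n_subsets)
  with fin obtain d where d: "\<And>S. S \<in> T \<Longrightarrow> int p dvd (\<Sum>A\<in>F. d A * w A S)"
      and "\<exists>A\<in>F. \<not> int p dvd d A"
    using nontrivial_relation_mod[of F T p w] prime_gt_1_nat[OF assms(1)] by blast
  then obtain B where B: "B \<in> F" "\<not> int p dvd d B"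
    by blast
  have "int p dvd (\<Sum>S\<in>T. w B S * (\<Sum>A\<in>F. d A * w A S))"
    by (rule dvd_sum, rule dvd_mult, rule d)
  also have "\<dots> = (\<Sum>A\<in>F. d A * (\<Sum>S\<in>T. w A S * w B S))"
    unfolding sum_distrib_left by (subst sum.swap) (simp add: mult_ac)
  also have "\<dots> = (\<Sum>A\<in>F. d A * int (card (A \<inter> B) choose (p ^ e - 1)))"
    unfolding T_def w_def
    using F assms(2) by (intro sum.cong refl arg_cong2[of _ _ _ _ "(*)"] sum_subset_indicators) auto
  also have "\<dots> = d B * int ((2 * p ^ e - 1) choose (p ^ e - 1))
      + (\<Sum>A\<in>F - {B}. d A * int (card (A \<inter> B) choose (p ^ e - 1)))"
    using B F fin by (subst sum.remove[of _ B]) auto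
  finally have dvd: "int p dvd d B * int ((2 * p ^ e - 1) choose (p ^ e - 1))
      + (\<Sum>A\<in>F - {B}. d A * int (card (A \<inter> B) choose (p ^ e - 1)))" .
  have "int p dvd (\<Sum>A\<in>F - {B}. d A * int (card (A \<inter> B) choose (p ^ e - 1)))"
  proof (rule dvd_sum)
    fix A assume A: "A \<in> F - {B}"
    have sub: "A \<subseteq> V" "B \<subseteq> V" "card A = 2 * p ^ e - 1" "card B = 2 * p ^ e - 1"
      using A B F by auto
    then have finAB: "finite A" "finite B"
      using assms(2) by (auto intro: finite_subset)
    have "A \<inter> B \<noteq> A"
      using A sub finAB by (metis DiffE card_subset_eq inf.absorb_iff1 singletonI)
    then have "card (A \<inter> B) < 2 * p ^ e - 1"
      using finAB sub by (metis Int_lower1 psubsetI psubset_card_mono)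
    then have "p dvd card (A \<inter> B) choose (p ^ e - 1)"
      using A B avoid assms(1) by (intro prime_dvd_choose_prime_power_minus_1) auto
    then show "int p dvd d A * int (card (A \<inter> B) choose (p ^ e - 1))"
      by simp
  qed
  with dvd have "int p dvd d B * int ((2 * p ^ e - 1) choose (p ^ e - 1))"
    by (simp add: dvd_add_left_iff)
  then have "int p dvd d B \<or> int p dvd int ((2 * p ^ e - 1) choose (p ^ e - 1))"
    using assms(1) by (simp add: prime_dvd_mult_iff)
  then show False
    using B prime_not_dvd_choose_prime_power_minus_1[OF assms(1), of e] by simp
qed

text \<open>Otherwise every color class avoids the intersection size \<open>p ^ e - 1\<close>, and
  the classes together are too small to cover all sets.\<close>

lemma monochromatic_intersection:
  fixes p :: nat
  assumes "prime p" "finite V" "finite C"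
    and f: "\<And>A. A \<subseteq> V \<Longrightarrow> card A = 2 * p ^ e - 1 \<Longrightarrow> f A \<in> C"
    and less: "card C * (card V choose (p ^ e - 1)) < card V choose (2 * p ^ e - 1)"
  obtains A B where "A \<subseteq> V" "B \<subseteq> V" "card A = 2 * p ^ e - 1" "card B = 2 * p ^ e - 1"
    "card (A \<inter> B) = p ^ e - 1" "f A = f B"
proof (rule ccontr)
  assume no: "\<not> thesis"
  define U where "U = {A. A \<subseteq> V \<and> card A = 2 * p ^ e - 1}"
  have "card {A \<in> U. f A = c} \<le> card V choose (p ^ e - 1)" for c
  proof (rule frankl_wilson[OF assms(1,2)])
    fix A B assume "A \<in> {A \<in> U. f A = c}" "B \<in> {A \<in> U. f A = c}"
    then show "card (A \<inter> B) \<noteq> p ^ e - 1"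
      using no that[of A B] by (auto simp: U_def)
  qed (auto simp: U_def)
  then have "(\<Sum>c\<in>C. card {A \<in> U. f A = c}) \<le> card C * (card V choose (p ^ e - 1))"
    using sum_bounded_above[of C "\<lambda>c. card {A \<in> U. f A = c}"] by simp
  moreover have "card U \<le> (\<Sum>c\<in>C. card {A \<in> U. f A = c})"
  proof -
    have "U = (\<Union>c\<in>C. {A \<in> U. f A = c})"
      using f by (auto simp: U_def)
    then show ?thesis
      using card_UN_le[OF assms(3), of "\<lambda>c. {A \<in> U. f A = c}"] by simp
  qed
  moreover have "card U = card V choose (2 * p ^ e - 1)"
    using assms(2) by (simp add: U_def n_subsets)
  ultimately show False
    using less by simp
qed

section \<open>Two layers of sets and their blow-up\<close>

text \<open>Both layers must meet correctly at once. For each fixed \<open>A\<close> the inner layer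
  yields a monochromatic pair; recoloring \<open>A\<close> by this pair and its color reduces the
  outer layer to the one-layer case, with the squared factor in \<open>less\<close> counting the
  pairs.\<close>

lemma two_layer_monochromatic:
  fixes p p' e e' :: nat and f :: "'a set \<Rightarrow> 'b set \<Rightarrow> 'c"
  assumes q_def: "q = p ^ e" and q'_def: "q' = p' ^ e'"
    and "prime p" "prime p'" "finite V" "finite V'" "finite C"
    and f: "\<And>A X. A \<subseteq> V \<Longrightarrow> card A = 2 * q - 1 \<Longrightarrow> X \<subseteq> V' \<Longrightarrow> card X = 2 * q' - 1 \<Longrightarrow> f A X \<in> C"
    and less': "card C * (card V' choose (q' - 1)) < card V' choose (2 * q' - 1)"
    and less: "(card V' choose (2 * q' - 1)) ^ 2 * card C * (card V choose (q - 1))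
      < card V choose (2 * q - 1)"
  obtains A B X Y where "A \<subseteq> V" "B \<subseteq> V" "card A = 2 * q - 1" "card B = 2 * q - 1"
    "card (A \<inter> B) = q - 1" "X \<subseteq> V'" "Y \<subseteq> V'" "card X = 2 * q' - 1" "card Y = 2 * q' - 1"
    "card (X \<inter> Y) = q' - 1" "f A X = f B Y"
proof -
  define U where "U = {X. X \<subseteq> V' \<and> card X = 2 * q' - 1}"
  have "\<exists>X Y. X \<in> U \<and> Y \<in> U \<and> card (X \<inter> Y) = q' - 1 \<and> f A X = f A Y"
    if "A \<subseteq> V" "card A = 2 * q - 1" for A
  proof -
    obtain X Y where "X \<subseteq> V'" "Y \<subseteq> V'" "card X = 2 * q' - 1" "card Y = 2 * q' - 1"
        "card (X \<inter> Y) = q' - 1" "f A X = f A Y"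
    proof (rule monochromatic_intersection[of p' V' C e' "f A"])
      show "f A X \<in> C" if "X \<subseteq> V'" "card X = 2 * p' ^ e' - 1" for X
        using f \<open>A \<subseteq> V\<close> \<open>card A = 2 * q - 1\<close> that by (simp add: q'_def)
    qed (use assms in \<open>auto simp: q'_def\<close>)
    then show ?thesis unfolding U_def by blast
  qed
  then have "\<forall>A. \<exists>Z. A \<subseteq> V \<and> card A = 2 * q - 1 \<longrightarrow> fst Z \<in> U \<and> snd Z \<in> U \<and>
      card (fst Z \<inter> snd Z) = q' - 1 \<and> f A (fst Z) = f A (snd Z)"
    by simp
  from choice[OF this] obtain Z where Z: "A \<subseteq> V \<Longrightarrow> card A = 2 * q - 1 \<Longrightarrow> fst (Z A) \<in> U \<and> snd (Z A) \<in> U \<and>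
      card (fst (Z A) \<inter> snd (Z A)) = q' - 1 \<and> f A (fst (Z A)) = f A (snd (Z A))" for A
    by blast
  define X Y where "X A = fst (Z A)" and "Y A = snd (Z A)" for A
  have XY: "X A \<in> U" "Y A \<in> U" "card (X A \<inter> Y A) = q' - 1" "f A (X A) = f A (Y A)"
    if "A \<subseteq> V" "card A = 2 * q - 1" for A
    using Z[OF that] by (auto simp: X_def Y_def)
  define g where "g A = ((X A, Y A), f A (X A))" for A
  have cardU: "card U = card V' choose (2 * q' - 1)" and finU: "finite U"
    using assms by (auto simp: U_def n_subsets intro: finite_subset[of _ "Pow V'"])
  have "card ((U \<times> U) \<times> C) = (card V' choose (2 * q' - 1)) ^ 2 * card C"
    by (simp add: card_cartesian_product cardU power2_eq_square)
  moreover have "g A \<in> (U \<times> U) \<times> C" if "A \<subseteq> V" "card A = 2 * q - 1" for A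
    using XY(1,2)[OF that] f[OF that] by (auto simp: g_def U_def)
  ultimately obtain A B where AB: "A \<subseteq> V" "B \<subseteq> V" "card A = 2 * q - 1" "card B = 2 * q - 1"
      "card (A \<inter> B) = q - 1" "g A = g B"
    using monochromatic_intersection[of p V "(U \<times> U) \<times> C" e g] finU assms(3,5,7) less
    unfolding q_def by (metis finite_cartesian_product)
  \<comment> \<open>Equality of \<open>g\<close> means that \<open>A\<close> and \<open>B\<close>
    share the pair and the color, so \<open>f A (X A) = f B (X B) = f B (Y B)\<close>.\<close>
  then have "f A (X A) = f B (Y B)" "card (X A \<inter> Y B) = q' - 1"
    using XY(3,4)[of B] XY(3)[of A] by (auto simp: g_def)
  then show thesis
    using that[of A B "X A" "Y B"] AB XY(1,2) unfolding U_def by blast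
qed

text \<open>Blowing up turns the two small intersection sizes into the single size
  \<open>k - r\<close>; the condition on \<open>n\<close> makes room for all blocks and the
  \<open>l\<close> common points.\<close>

lemma johnson_monochromatic:
  fixes p p' e e' :: nat and f :: "nat set \<Rightarrow> nat"
  assumes q_def: "q = p ^ e" and q'_def: "q' = p' ^ e'"
    and "prime p" "prime p'" "finite C"
    and f: "\<And>A. A \<subseteq> {1..n} \<Longrightarrow> card A = k \<Longrightarrow> f A \<in> C"
    and less': "card C * (N' choose (q' - 1)) < N' choose (2 * q' - 1)"
    and less: "(N' choose (2 * q' - 1)) ^ 2 * card C * (N choose (q - 1)) < N choose (2 * q - 1)"
    and r: "r = q * m + q' * m'"
    and k: "k = (2 * q - 1) * m + (2 * q' - 1) * m' + l"
    and n: "N * m + N' * m' + l \<le> n"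
  obtains A B where "A \<subseteq> {1..n}" "B \<subseteq> {1..n}" "card A = k" "card B = k"
    "card (A \<inter> B) = k - r" "f A = f B"
proof -
  \<comment> \<open>Each point of the two small ground sets becomes a block of \<open>m\<close> or \<open>m'\<close> points; the last summand
    holds the \<open>l\<close> points common to all sets and the unused points.\<close>
  define \<Omega> :: "((nat \<times> nat) + (nat \<times> nat) + nat) set"
    where "\<Omega> = Sum_Type.Plus ({..<N} \<times> {..<m}) (Sum_Type.Plus ({..<N'} \<times> {..<m'}) {..<n - N * m - N' * m'})"
  have "card \<Omega> = n" "finite \<Omega>"
    using n by (auto simp: \<Omega>_def card_Plus card_cartesian_product)
  then obtain h where h: "bij_betw h \<Omega> {1..n}"
    using ex_bij_betw_nat_finite_1 bij_betw_inv by blast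
  then have inj: "inj_on h \<Omega>"
    by (rule bij_betw_imp_inj_on)
  define \<psi> :: "nat set \<Rightarrow> nat set \<Rightarrow> ((nat \<times> nat) + (nat \<times> nat) + nat) set"
    where "\<psi> A X = Sum_Type.Plus (A \<times> {..<m}) (Sum_Type.Plus (X \<times> {..<m'}) {..<l})" for A X
  have sub: "\<psi> A X \<subseteq> \<Omega>" if "A \<subseteq> {..<N}" "X \<subseteq> {..<N'}" for A X
    using that n unfolding \<psi>_def \<Omega>_def by fastforce
  have card: "card (\<psi> A X) = card A * m + card X * m' + l" if "A \<subseteq> {..<N}" "X \<subseteq> {..<N'}" for A X
    using finite_subset[OF that(1)] finite_subset[OF that(2)]
    by (simp add: \<psi>_def card_Plus card_cartesian_product)
  have int: "\<psi> A X \<inter> \<psi> B Y = \<psi> (A \<inter> B) (X \<inter> Y)" for A B X Y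
    unfolding \<psi>_def by auto
  have h_sub: "h ` \<psi> A X \<subseteq> {1..n}" and h_card: "card (h ` \<psi> A X) = card A * m + card X * m' + l"
    if "A \<subseteq> {..<N}" "X \<subseteq> {..<N'}" for A X
    using sub[OF that] card[OF that] inj h
    by (auto simp: card_image inj_on_subset bij_betw_def)
  have h_int: "card (h ` \<psi> A X \<inter> h ` \<psi> B Y) = card (A \<inter> B) * m + card (X \<inter> Y) * m' + l"
    if "A \<subseteq> {..<N}" "X \<subseteq> {..<N'}" "B \<subseteq> {..<N}" "Y \<subseteq> {..<N'}" for A B X Y
  proof -
    have eq: "h ` \<psi> A X \<inter> h ` \<psi> B Y = h ` \<psi> (A \<inter> B) (X \<inter> Y)"
      using inj_on_image_Int[OF inj sub sub] that by (simp add: int)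
    then show ?thesis using that unfolding eq by (subst h_card) auto
  qed
  obtain A B X Y where AB: "A \<subseteq> {..<N}" "B \<subseteq> {..<N}" "card A = 2 * q - 1" "card B = 2 * q - 1"
      "card (A \<inter> B) = q - 1" "X \<subseteq> {..<N'}" "Y \<subseteq> {..<N'}" "card X = 2 * q' - 1" "card Y = 2 * q' - 1"
      "card (X \<inter> Y) = q' - 1" "f (h ` \<psi> A X) = f (h ` \<psi> B Y)"
  proof (rule two_layer_monochromatic[where f = "\<lambda>A X. f (h ` \<psi> A X)", OF q_def q'_def assms(3,4)])
    show "f (h ` \<psi> A X) \<in> C" if "A \<subseteq> {..<N}" "card A = 2 * q - 1" "X \<subseteq> {..<N'}"
      "card X = 2 * q' - 1" for A X
      using that k h_sub[of A X] h_card[of A X] by (intro f) auto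
    show "card C * (card {..<N'} choose (q' - 1)) < card {..<N'} choose (2 * q' - 1)"
      using less' by simp
    show "(card {..<N'} choose (2 * q' - 1)) ^ 2 * card C * (card {..<N} choose (q - 1))
        < card {..<N} choose (2 * q - 1)"
      using less by simp
  qed (rule finite_lessThan, rule finite_lessThan, rule assms(5), blast)
  have pos: "0 < q" "0 < q'"
    using assms(3,4) by (auto simp: q_def q'_def prime_gt_0_nat)
  \<comment> \<open>The set size \<open>2 * q - 1\<close> exceeds the intersection size
    \<open>q - 1\<close> by exactly \<open>q\<close>, and likewise for \<open>q'\<close>, so the
    total loss is \<open>q * m + q' * m' = r\<close>.\<close>
  have "k = ((q - 1) * m + (q' - 1) * m' + l) + r"
  proof -
    have "2 * q - 1 = (q - 1) + q" "2 * q' - 1 = (q' - 1) + q'"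
      using pos by auto
    then show ?thesis
      unfolding k r by (simp add: add_mult_distrib)
  qed
  then have kr: "k - r = (q - 1) * m + (q' - 1) * m' + l"
    by simp
  show thesis
    by (rule that[of "h ` \<psi> A X" "h ` \<psi> B Y"])
      (use AB h_sub h_card h_int k kr in auto)
qed

section \<open>A ratio estimate for binomial coefficients\<close>

text \<open>The quotient of the coefficients is a product of factors
  \<open>(a - i) / (b - i)\<close>, each at most \<open>4 / 5\<close>. Multiplying by
  \<open>Suc j\<close> keeps the induction in natural numbers.\<close>

lemma choose_ratio:
  fixes a b j :: nat
  assumes "5 * a \<le> 4 * b"
  shows "5 ^ j * (a choose j) \<le> 4 ^ j * (b choose j)"
proof (induction j)
  case (Suc j)
  have step: "Suc j * (x choose Suc j) = (x - j) * (x choose j)" for x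
    unfolding binomial_absorption binomial_absorb_comp ..
  have "Suc j * (5 ^ Suc j * (a choose Suc j)) = 5 ^ Suc j * (Suc j * (a choose Suc j))"
    by (rule mult.left_commute)
  also have "\<dots> = (5 ^ j * (a choose j)) * (5 * (a - j))"
    unfolding step by (simp only: power_Suc mult_ac)
  also have "\<dots> \<le> (4 ^ j * (b choose j)) * (4 * (b - j))"
    using assms by (intro mult_le_mono[OF Suc.IH]) auto
  also have "\<dots> = 4 ^ Suc j * (Suc j * (b choose Suc j))"
    unfolding step by (simp only: power_Suc mult_ac)
  also have "\<dots> = Suc j * (4 ^ Suc j * (b choose Suc j))"
    by (rule mult.left_commute)
  finally show ?case
    by (simp only: mult_le_cancel1)
qed simp

section \<open>Quantum colorings from unimodular vectors\<close>

text \<open>For a vector of squared norm \<open>n\<close>, such as one with unimodular entries, this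
  is the orthogonal projector onto its line.\<close>

definition scaled_outer :: "nat \<Rightarrow> (nat \<Rightarrow> complex) \<Rightarrow> complex mat" where
  "scaled_outer n u = mat n n (\<lambda>(i, j). u i * cnj (u j) / of_nat n)"

lemma scaled_outer_mult:
  "scaled_outer n u * scaled_outer n v =
    mat n n (\<lambda>(i, j). u i * cnj (v j) * (\<Sum>l<n. cnj (u l) * v l) / (of_nat n)\<^sup>2)"
  by (rule eq_matI)
    (auto simp: scaled_outer_def scalar_prod_def sum_distrib_left sum_divide_distrib
      atLeast0LessThan power2_eq_square mult_ac)

lemma hermitian_projector_scaled_outer:
  assumes "(\<Sum>l<n. cnj (u l) * u l) = of_nat n"
  shows "hermitian_projector n (scaled_outer n u)"
  unfolding hermitian_projector_def
proof (intro conjI)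
  show "scaled_outer n u \<in> carrier_mat n n" by (simp add: scaled_outer_def)
  show "mat_adjoint (scaled_outer n u) = scaled_outer n u"
    unfolding mat_adjoint_entrywise by (rule eq_matI) (auto simp: scaled_outer_def)
  show "scaled_outer n u * scaled_outer n u = scaled_outer n u"
    unfolding scaled_outer_mult assms
    by (rule eq_matI) (auto simp: scaled_outer_def power2_eq_square)
qed

lemma scaled_outer_mult_eq_0:
  assumes "(\<Sum>l<n. cnj (u l) * v l) = 0"
  shows "scaled_outer n u * scaled_outer n v = 0\<^sub>m n n"
  unfolding scaled_outer_mult assms by (rule eq_matI) auto

text \<open>Orthogonality of the characters of the cyclic group: a geometric sum whose ratio is an
  \<open>n\<close>-th root of unity, equal to 1 exactly when \<open>n\<close> divides
  \<open>d\<close>.\<close>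

lemma sum_cis_root_of_unity:
  fixes d :: int
  assumes "n > 0"
  shows "(\<Sum>l<n. cis (2 * pi * of_int d / of_nat n * of_nat l))
    = (if int n dvd d then of_nat n else 0)"
proof -
  define z where "z = cis (2 * pi * of_int d / of_nat n)"
  have z_pow: "cis (2 * pi * of_int d / of_nat n * of_nat l) = z ^ l" for l
    by (simp add: z_def DeMoivre mult.commute)
  have "z ^ n = cis (2 * pi * of_int d)"
    unfolding z_pow[symmetric] using assms by simp
  then have zn: "z ^ n = 1"
    by simp
  have z1: "z = 1 \<longleftrightarrow> int n dvd d"
  proof -
    have "z = 1 \<longleftrightarrow> cos (2 * pi * of_int d / of_nat n) = 1"
      by (auto simp: z_def complex_eq_iff dest: cos_one_sin_zero)
    also have "\<dots> \<longleftrightarrow> (\<exists>k::int. 2 * pi * of_int d / of_nat n = of_int k * 2 * pi)"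
      by (rule cos_one_2pi_int)
    also have "\<dots> \<longleftrightarrow> (\<exists>k::int. (of_int d :: real) = of_int (int n * k))"
      using assms by (intro arg_cong[of _ _ Ex] ext) (auto simp: field_simps)
    also have "\<dots> \<longleftrightarrow> int n dvd d"
      unfolding of_int_eq_iff dvd_def ..
    finally show ?thesis .
  qed
  show ?thesis
  proof (cases "z = 1")
    case True
    then show ?thesis using z1 unfolding z_pow by simp
  next
    case False
    then show ?thesis using z1 zn unfolding z_pow by (simp add: geometric_sum)
  qed
qed

text \<open>Since the entries are unimodular, the \<open>n\<close> twists of one vector by
  characters form an orthogonal basis. On an arc, equal characters cancel and leave the inner
  product of the original vectors.\<close>

lemma quantum_coloring_of_flat_orthogonal_representation:
  fixes x :: "'a \<Rightarrow> nat \<Rightarrow> complex"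
  assumes n: "n > 0"
    and flat: "\<And>v i. v \<in> pverts G \<Longrightarrow> i < n \<Longrightarrow> cmod (x v i) = 1"
    and orth: "\<And>u v. (u, v) \<in> parcs G \<Longrightarrow> (\<Sum>i<n. cnj (x u i) * x v i) = 0"
  shows "\<exists>P. quantum_coloring G n n P"
proof
  define w where "w \<alpha> i = cis (2 * pi * of_int (int \<alpha>) / of_nat n * of_nat i)" for \<alpha> i
  define u where "u v \<alpha> i = x v i * w \<alpha> i" for v \<alpha> i
  define P where "P v \<alpha> = scaled_outer n (u v \<alpha>)" for v \<alpha>
  have cnj_w: "cnj (w \<alpha> i) * w \<beta> i = cis (2 * pi * of_int (int \<beta> - int \<alpha>) / of_nat n * of_nat i)" for \<alpha> \<beta> i
    unfolding w_def cis_cnj cis_mult by (rule arg_cong[of _ _ cis]) (use n in \<open>simp add: field_simps\<close>)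
  have w_cnj: "w \<alpha> i * cnj (w \<alpha> j) = cis (2 * pi * of_int (int i - int j) / of_nat n * of_nat \<alpha>)" for \<alpha> i j
    unfolding w_def cis_cnj cis_mult by (rule arg_cong[of _ _ cis]) (use n in \<open>simp add: field_simps\<close>)
  have x1: "cnj (x v i) * x v i = 1" if "v \<in> pverts G" "i < n" for v i
    using flat[OF that] by (metis complex_norm_square mult.commute of_real_1 one_power2)
  have self: "(\<Sum>l<n. cnj (u v \<alpha> l) * u v \<beta> l) = (if int n dvd int \<beta> - int \<alpha> then of_nat n else 0)"
    if "v \<in> pverts G" for v \<alpha> \<beta>
  proof -
    have "(\<Sum>l<n. cnj (u v \<alpha> l) * u v \<beta> l) = (\<Sum>l<n. cnj (w \<alpha> l) * w \<beta> l)"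
      using x1[OF that] by (intro sum.cong refl) (simp add: u_def algebra_simps)
    then show ?thesis
      unfolding cnj_w by (simp only: sum_cis_root_of_unity[OF n])
  qed
  have dvd: "int n dvd int \<beta> - int \<alpha> \<longleftrightarrow> \<alpha> = \<beta>" if "\<alpha> \<in> {1..n}" "\<beta> \<in> {1..n}" for \<alpha> \<beta>
  proof
    assume "int n dvd int \<beta> - int \<alpha>"
    moreover have "\<bar>int \<beta> - int \<alpha>\<bar> < int n" using that by auto
    ultimately show "\<alpha> = \<beta>" using zdvd_not_zless[of "\<bar>int \<beta> - int \<alpha>\<bar>" "int n"] by auto
  qed simp
  have sum: "finsum (ring_mat TYPE(complex) n ()) (P v) {1..n} = 1\<^sub>m n" if v: "v \<in> pverts G" for v
  proof -
    have "(\<Sum>\<alpha>\<in>{1..n}. P v \<alpha> $$ (i, j)) = (if i = j then 1 else 0)" if ij: "i < n" "j < n" for i j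
    proof -
      have "(\<Sum>\<alpha>\<in>{1..n}. P v \<alpha> $$ (i, j))
          = x v i * cnj (x v j) / of_nat n * (\<Sum>\<alpha>\<in>{1..n}. w \<alpha> i * cnj (w \<alpha> j))"
        using ij by (auto simp: P_def scaled_outer_def u_def sum_distrib_left intro!: sum.cong)
      also have "(\<Sum>\<alpha>\<in>{1..n}. w \<alpha> i * cnj (w \<alpha> j)) = (\<Sum>\<alpha><n. w \<alpha> i * cnj (w \<alpha> j))"
      proof -
        \<comment> \<open>Colors run from 1 to \<open>n\<close> but the character sum from 0; color
          \<open>n\<close> is the trivial character.\<close>
        have "w n i = w 0 i" for i
        proof -
          have "w n i = cis (2 * pi * of_int (int i))"
            using n by (simp add: w_def)
          then show ?thesis by (simp add: w_def)
        qed
        moreover have "{1..n} = insert n {1..<n}" "{..<n} = insert 0 {1..<n}"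
          using n by auto
        ultimately show ?thesis by simp
      qed
      also have "\<dots> = (if int n dvd int i - int j then of_nat n else 0)"
        unfolding w_cnj by (rule sum_cis_root_of_unity[OF n])
      \<comment> \<open>The fact \<open>dvd\<close> speaks of \<open>{1..n}\<close>, hence the shift
        of both indices by one.\<close>
      also have "int n dvd int i - int j \<longleftrightarrow> i = j"
        using dvd[of "Suc j" "Suc i"] ij by auto
      finally show ?thesis
        using x1[OF v ij(1)] n by (auto simp: mult.commute)
    qed
    then show ?thesis
      by (subst finsum_ring_mat) (auto simp: P_def scaled_outer_def)
  qed
  show "quantum_coloring G n n P"
    unfolding quantum_coloring_def
  proof (intro conjI ballI impI)
    fix v \<alpha> assume "v \<in> pverts G"
    then show "hermitian_projector n (P v \<alpha>)"
      unfolding P_def by (intro hermitian_projector_scaled_outer) (simp add: self)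
  next
    fix v \<alpha> \<beta> assume "v \<in> pverts G" "\<alpha> \<in> {1..n}" "\<beta> \<in> {1..n}" "\<alpha> \<noteq> \<beta>"
    then show "P v \<alpha> * P v \<beta> = 0\<^sub>m n n"
      unfolding P_def by (intro scaled_outer_mult_eq_0) (simp add: self dvd)
  next
    show "case e of (a, b) \<Rightarrow> \<forall>\<alpha>\<in>{1..n}. P a \<alpha> * P b \<alpha> = 0\<^sub>m n n" if e: "e \<in> parcs G" for e
    proof (cases e)
      case (Pair a b)
      have "(\<Sum>l<n. cnj (u a \<alpha> l) * u b \<alpha> l) = (\<Sum>l<n. cnj (x a l) * x b l)" for \<alpha>
      proof (intro sum.cong refl)
        fix l
        have "cnj (w \<alpha> l) * w \<alpha> l = 1" by (simp add: cnj_w)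
        then show "cnj (u a \<alpha> l) * u b \<alpha> l = cnj (x a l) * x b l"
          by (simp add: u_def algebra_simps)
      qed
      then show ?thesis
        using Pair e orth by (auto simp: P_def intro: scaled_outer_mult_eq_0)
    qed
  qed (use n sum in auto)
qed

text \<open>For adjacent \<open>A\<close> and \<open>B\<close>, points in both or neither contribute
  1, the \<open>r\<close> points of \<open>A - B\<close> contribute \<open>cnj z\<close>, and the
  \<open>r\<close> points of \<open>B - A\<close> contribute \<open>z\<close>. The total
  \<open>n + r * (2 * Re z - 2)\<close> vanishes by the choice of \<open>c\<close>.\<close>

lemma quantum_chromatic_number_johnson_le:
  assumes r: "0 < r" "r \<le> k" "n \<le> 4 * r" and n: "0 < n"
  shows "quantum_chromatic_number (gen_johnson_graph n k (k - r)) \<le> n"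
proof -
  define G where "G = gen_johnson_graph n k (k - r)"
  define c where "c = 1 - real n / (2 * real r)"
  define z where "z = cis (arccos c)"
  have "-1 \<le> c" "c \<le> 1"
    using r by (auto simp: c_def field_simps)
  then have "Re z = c"
    by (simp add: z_def)
  then have zz: "z + cnj z = of_real (2 * c)"
    by (simp add: complex_eq_iff)
  have z1: "cmod z = 1" "cnj z * z = 1"
    by (auto simp: z_def cis_cnj cis_mult)
  define x where "x A i = (if Suc i \<in> A then z else 1)" for A :: "nat set" and i :: nat
  have "\<exists>P. quantum_coloring G n n P"
  proof (rule quantum_coloring_of_flat_orthogonal_representation[where x = x])
    fix A B assume AB: "(A, B) \<in> parcs G"
    then have A: "A \<subseteq> {1..n}" "card A = k" and B: "B \<subseteq> {1..n}" "card B = k"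
      and I: "card (A \<inter> B) = k - r"
      by (auto simp: G_def gen_johnson_graph_def Let_def)
    have fin: "finite A" "finite B"
      using A B by (auto intro: finite_subset)
    \<comment> \<open>The bound \<open>r \<le> k\<close> makes the truncated difference
      \<open>k - (k - r)\<close> equal to \<open>r\<close>.\<close>
    have dA: "card (A - B) = r" and dB: "card (B - A) = r"
      using fin A B I r by (simp_all add: card_Diff_subset_Int Int_commute)
    have "(\<Sum>i<n. cnj (x A i) * x B i)
        = (\<Sum>i\<in>{1..n}. (if i \<in> A then cnj z else 1) * (if i \<in> B then z else 1))"
      unfolding x_def by (rule sum.reindex_bij_witness[of _ "\<lambda>i. i - 1" Suc]) auto
    also have "\<dots> = (\<Sum>i\<in>{1..n}. 1 + (of_bool (i \<in> A - B) * (cnj z - 1) + of_bool (i \<in> B - A) * (z - 1)))"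
      by (rule sum.cong) (auto simp: z1)
    also have "\<dots> = of_nat n + (of_nat (card (A - B)) * (cnj z - 1) + of_nat (card (B - A)) * (z - 1))"
    proof -
      have *: "(\<Sum>i\<in>{1..n}. of_bool (i \<in> C)) = (of_nat (card C) :: complex)" if "C \<subseteq> {1..n}" for C
      proof -
        have "{1..n} \<inter> C = C" using that by auto
        then show ?thesis by (simp add: of_bool_def sum.If_cases)
      qed
      have "A - B \<subseteq> {1..n}" "B - A \<subseteq> {1..n}" using A B by auto
      then show ?thesis
        unfolding sum.distrib sum_distrib_right[symmetric] by (simp only: *) simp
    qed
    also have "\<dots> = of_nat n + of_nat r * (z + cnj z - 2)"
      unfolding dA dB by (simp add: algebra_simps)
    also have "\<dots> = of_real (real n + real r * (2 * c - 2))"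
      unfolding zz by simp
    also have "real n + real r * (2 * c - 2) = 0"
      using r by (simp add: c_def field_simps)
    finally show "(\<Sum>i<n. cnj (x A i) * x B i) = 0" by simp
  qed (use n z1 in \<open>auto simp: x_def G_def gen_johnson_graph_def Let_def\<close>)
  then show ?thesis
    using n unfolding quantum_chromatic_number_def G_def by (intro Least_le) blast
qed

section \<open>Choice of parameters and numerical estimates\<close>

text \<open>The inner layer uses 5-sets in \<open>q ^ 4\<close> points. Splitting a 5-set into 2 and
  3 points reduces the claim to \<open>10 * n < (q ^ 4 - 2) choose 3\<close>, whose right side has
  order \<open>q ^ 12\<close> against \<open>q ^ 8\<close>.\<close>

lemma choose_5_gt:
  fixes q n :: nat
  assumes "32 \<le> q" "n \<le> 1024 * q ^ 8"
  shows "n * (q ^ 4 choose 2) < q ^ 4 choose 5"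
proof -
  have q4: "32 ^ 4 \<le> q ^ 4"
    using assms(1) by (rule power_mono) simp
  have "real (10 * n) \<le> 10240 * real q ^ 8"
    using of_nat_mono[OF assms(2), where 'a = real] by simp
  \<comment> \<open>The constant 32 comes from here: \<open>32 ^ 4 / 64 = 16384\<close> exceeds
    10240.\<close>
  also have "\<dots> < (32 ^ 4 / 64) * real q ^ 8"
    using assms(1) by simp
  also have "\<dots> \<le> (real q ^ 4 / 64) * real q ^ 8"
    using of_nat_mono[OF q4, where 'a = real] by (intro mult_right_mono) auto
  also have "\<dots> = (real q ^ 4 / 4) ^ 3"
    by (simp add: power_divide power_mult[symmetric] power_add[symmetric])
  also have "\<dots> \<le> (real (q ^ 4 - 2) / real 3) ^ 3"
  proof (intro power_mono)
    have "real (32 ^ 4) \<le> real (q ^ 4)"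
      using q4 by (simp only: of_nat_le_iff)
    moreover have "real (q ^ 4 - 2) = real (q ^ 4) - 2"
      using q4 by simp
    ultimately show "real q ^ 4 / 4 \<le> real (q ^ 4 - 2) / real 3"
      by simp
  qed simp
  also have "\<dots> \<le> real ((q ^ 4 - 2) choose 3)"
    using q4 by (intro binomial_ge_n_over_k_pow_k) simp
  finally have "10 * n < (q ^ 4 - 2) choose 3"
    by (simp only: of_nat_less_iff)
  moreover have "0 < q ^ 4 choose 2"
    using q4 by simp
  ultimately have "(q ^ 4 choose 2) * (10 * n) < (q ^ 4 choose 2) * ((q ^ 4 - 2) choose 3)"
    by simp
  also have "\<dots> = (q ^ 4 choose 5) * (5 choose 2)"
    using choose_mult[of 2 5 "q ^ 4"] q4 by simp
  also have "(5 choose 2) = (10 :: nat)"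
    by (simp add: choose_two)
  finally show ?thesis by (simp add: mult.commute)
qed

text \<open>Counting \<open>(q - 1)\<close>-sets inside \<open>(2 * q - 1)\<close>-sets in two ways
  turns the quotient of the two sides into \<open>(3 * q - 3) choose q\<close> over
  \<open>(2 * q - 1) choose q\<close>, which is at least \<open>(5 / 4) ^ q\<close>.\<close>

lemma choose_double_gt:
  fixes q K :: nat
  assumes "4 \<le> q" "K * 4 ^ q < 5 ^ q"
  shows "K * ((4 * q - 4) choose (q - 1)) < (4 * q - 4) choose (2 * q - 1)"
proof -
  define a where "a = (4 * q - 4) choose (q - 1)"
  define b where "b = (2 * q - 1) choose q"
  define t where "t = (4 * q - 4) choose (2 * q - 1)"
  have pos: "0 < a" "0 < b"
    using assms(1) by (auto simp: a_def b_def)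
  have "(2 * q - 1) choose (q - 1) = b"
    unfolding b_def using assms(1) binomial_symmetric[of q "2 * q - 1"] by simp
  then have tb: "t * b = a * ((3 * q - 3) choose q)"
    using choose_mult[of "q - 1" "2 * q - 1" "4 * q - 4"] assms(1) by (simp add: a_def t_def)
  have "5 ^ q * b \<le> 4 ^ q * ((3 * q - 3) choose q)"
    \<comment> \<open>The hypothesis reads \<open>10 * q - 5 \<le> 12 * q - 12\<close>, true from
      \<open>q = 4\<close> on.\<close>
    unfolding b_def by (rule choose_ratio) (use assms(1) in simp)
  then have "a * (5 ^ q * b) \<le> a * (4 ^ q * ((3 * q - 3) choose q))"
    by (rule mult_le_mono2)
  also have "\<dots> = 4 ^ q * (t * b)"
    unfolding tb by simp
  finally have "(a * 5 ^ q) * b \<le> (4 ^ q * t) * b"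
    by (simp only: mult.assoc)
  then have le: "a * 5 ^ q \<le> 4 ^ q * t"
    using pos by simp
  have "4 ^ q * (K * a) = a * (K * 4 ^ q)"
    by simp
  also have "\<dots> < a * 5 ^ q"
    using assms(2) pos by simp
  also note le
  finally have "K * a < t"
    by simp
  then show ?thesis
    by (simp add: a_def t_def)
qed

text \<open>Inverting 3 modulo \<open>q\<close> gives the residue \<open>m'\<close>. Its smallness
  keeps the inner blocks negligible beside the outer ones.\<close>

lemma decompose_mod_3:
  fixes q r :: nat
  assumes "coprime 3 q" "0 < q" "3 * q \<le> r"
  obtains m m' where "r = q * m + 3 * m'" "m' < q"
proof -
  obtain x where x: "[3 * x = 1] (mod q)"
    using cong_solve_coprime_nat[OF assms(1)] by auto
  define m' where "m' = (x * r) mod q"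
  have "m' < q"
    using assms(2) by (simp add: m'_def)
  have "[3 * m' = 3 * x * r] (mod q)"
    unfolding m'_def mult.assoc by (rule cong_scalar_left) simp
  also have "[3 * x * r = 1 * r] (mod q)"
    using x by (rule cong_scalar_right)
  finally have "[3 * m' = r] (mod q)"
    by (simp only: mult_1)
  then have "[r = 3 * m'] (mod q)"
    by (rule cong_sym)
  moreover have "3 * m' \<le> r"
    using \<open>m' < q\<close> assms(3) by simp
  ultimately have "q dvd r - 3 * m'"
    by (simp add: cong_altdef_nat)
  then obtain m where "r - 3 * m' = q * m" ..
  then show thesis
    using that[of m m'] \<open>3 * m' \<le> r\<close> \<open>m' < q\<close> by simp
qed

text \<open>Substituting \<open>r\<close> gives \<open>l = m + m' + (k - 2 * r)\<close> over the
  integers, and fitting into \<open>n\<close> leaves about \<open>3 * m\<close> points to spare. As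
  \<open>m\<close> has order at least \<open>q ^ 7\<close>, this absorbs the deviation of
  \<open>k\<close>, below \<open>16 * q ^ 4\<close>, and the inner ground set of
  \<open>q ^ 4 * m'\<close> points.\<close>

lemma johnson_parameters:
  fixes q r k n m m' :: nat
  assumes q: "32 \<le> q" and r: "q ^ 8 \<le> r" "r < 256 * q ^ 8"
    and n: "4 * r - 1 \<le> n" and k: "(int k - 2 * int r)\<^sup>2 \<le> int r"
    and m: "r = q * m + 3 * m'" "m' < q"
  obtains l where "k = (2 * q - 1) * m + 5 * m' + l" "(4 * q - 4) * m + q ^ 4 * m' + l \<le> n"
proof -
  define Q where "Q = q ^ 4"
  have "(int k - 2 * int r)\<^sup>2 < (16 * int Q)\<^sup>2"
  proof -
    have "int r < int (256 * q ^ 8)"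
      using r(2) by (simp only: of_nat_less_iff)
    also have "\<dots> = (16 * int Q)\<^sup>2"
      by (simp add: Q_def power_mult_distrib power_mult[symmetric])
    finally show ?thesis using k by simp
  qed
  then have dev: "\<bar>int k - 2 * int r\<bar> < 16 * int Q"
    using abs_le_square_iff[of "16 * int Q" "int k - 2 * int r"] by linarith
  \<comment> \<open>From \<open>m' < q\<close> follows \<open>r \<le> q * (m + 3)\<close>.\<close>
  have "q * q ^ 7 \<le> q * (m + 3)"
    using r(1) m by (simp add: power_Suc[symmetric] algebra_simps)
  then have m7: "q ^ 7 \<le> m + 3"
    using q by simp
  have "32 ^ 2 * (q * Q) \<le> q ^ 2 * (q * Q)"
    using q by (intro mult_le_mono1 power_mono) auto
  also have "\<dots> = q ^ 7"
    by (simp add: Q_def power_add[symmetric] power_Suc[symmetric])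
  finally have qQ: "1024 * (q * Q) \<le> m + 3"
    using m7 by simp
  have "32 * Q \<le> q * Q" "Q * m' \<le> q * Q" "1 \<le> Q"
    using q m(2) by (auto simp: Q_def)
  then have bounds: "1024 * (32 * Q) \<le> m + 3" "1024 * (Q * m') \<le> m + 3" "1 \<le> Q"
    using qQ by linarith+
  have r2: "int r = int (q * m) + 3 * int m'"
    using m(1) by simp
  have k1: "int ((2 * q - 1) * m) = 2 * int (q * m) - int m"
    using q by (simp add: algebra_simps)
  have n1: "int ((4 * q - 4) * m) = 4 * int (q * m) - 4 * int m"
    using q by (simp add: algebra_simps)
  have "int ((2 * q - 1) * m) + 5 * int m' \<le> int k"
    using dev r2 k1 bounds by linarith
  then have le: "(2 * q - 1) * m + 5 * m' \<le> k"
    by linarith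
  then obtain l where l: "k = (2 * q - 1) * m + 5 * m' + l"
    using le_Suc_ex by blast
  then have "int l = int k - int ((2 * q - 1) * m) - 5 * int m'"
    by linarith
  moreover have "4 * int r - 1 \<le> int n"
    using n by linarith
  ultimately have "int ((4 * q - 4) * m) + int (Q * m') + int l \<le> int n"
    using dev r2 k1 n1 bounds by linarith
  then have "(4 * q - 4) * m + q ^ 4 * m' + l \<le> n"
    unfolding Q_def by linarith
  with l show thesis ..
qed

lemma johnson_monochromatic_of_large:
  shows "\<exists>R. \<forall>r\<ge>R. \<forall>n k. \<forall>f :: nat set \<Rightarrow> nat.
    4 * r - 1 \<le> n \<longrightarrow> n \<le> 4 * r \<longrightarrow> (int k - 2 * int r)\<^sup>2 \<le> int r \<longrightarrow>
    (\<forall>A. A \<subseteq> {1..n} \<and> card A = k \<longrightarrow> f A \<in> {1..n}) \<longrightarrow>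
    (\<exists>A B. A \<subseteq> {1..n} \<and> B \<subseteq> {1..n} \<and> card A = k \<and> card B = k \<and>
      card (A \<inter> B) = k - r \<and> f A = f B)"
proof -
  \<comment> \<open>The auxiliary colors number at most
    \<open>(q ^ 20) ^ 2 * (1024 * q ^ 8)\<close>, which is \<open>1024 * q ^ 48\<close>.\<close>
  have "eventually (\<lambda>q::nat. 1024 * real q ^ 48 < (5 / 4) ^ q) at_top"
    by real_asymp
  then obtain Q0 where Q0: "1024 * real q ^ 48 < (5 / 4) ^ q" if "q \<ge> Q0" for q
    unfolding eventually_at_top_linorder by blast
  define Q where "Q = max Q0 32"
  show ?thesis
  \<comment> \<open>With \<open>r < 256 * q ^ 8\<close> below, this threshold forces
    \<open>Q < q\<close>.\<close>
  proof (intro exI[of _ "256 * Q ^ 8"] allI impI)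
    fix r n k :: nat and f :: "nat set \<Rightarrow> nat"
    assume r: "256 * Q ^ 8 \<le> r" and n: "4 * r - 1 \<le> n" "n \<le> 4 * r"
      and k: "(int k - 2 * int r)\<^sup>2 \<le> int r"
      and f: "\<forall>A. A \<subseteq> {1..n} \<and> card A = k \<longrightarrow> f A \<in> {1..n}"
    have "1 \<le> 256 * Q ^ 8"
      by (simp add: Q_def)
    then have "1 \<le> r"
      using r by linarith
    then obtain e where e: "256 ^ e \<le> r" "r < 256 ^ (e + 1)"
      using ex_power_ivl1[of 256 r] by auto
    \<comment> \<open>A power of 2 is a prime power coprime to 3, and \<open>256 = 2 ^ 8\<close>
      gives \<open>q ^ 8 \<le> r < 256 * q ^ 8\<close>.\<close>
    define q :: nat where "q = 2 ^ e"
    have q8: "256 ^ e = q ^ 8"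
    proof -
      have "(256 :: nat) ^ e = (2 ^ 8) ^ e" by simp
      then show ?thesis
        unfolding q_def power_mult[symmetric] by (simp only: mult.commute)
    qed
    have rq: "q ^ 8 \<le> r" "r < 256 * q ^ 8"
      using e q8 by auto
    then have "Q ^ 8 < q ^ 8"
      using r by linarith
    then have "Q < q"
      by (rule power_less_imp_less_base) simp
    then have q: "Q0 \<le> q" "32 \<le> q"
      by (auto simp: Q_def)
    have n_le: "n \<le> 1024 * q ^ 8"
      using n rq by linarith
    have "3 * q \<le> q ^ 7 * q"
    proof (rule mult_le_mono1)
      have "3 \<le> q ^ 1" using q by simp
      also have "\<dots> \<le> q ^ 7" using q by (intro power_increasing) auto
      finally show "3 \<le> q ^ 7" .
    qed
    also have "\<dots> = q ^ 8"
      by (simp add: power_Suc2[symmetric])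
    finally have "3 * q \<le> r"
      using rq by linarith
    moreover have "coprime 3 q"
      by (simp add: q_def)
    ultimately obtain m m' where m: "r = q * m + 3 * m'" "m' < q"
      using decompose_mod_3[of q r] q by auto
    obtain l where l: "k = (2 * q - 1) * m + 5 * m' + l" "(4 * q - 4) * m + q ^ 4 * m' + l \<le> n"
      using johnson_parameters[OF q(2) rq n(1) k m] .
    have "(q ^ 4 choose 5) ^ 2 * n \<le> ((q ^ 4) ^ 5) ^ 2 * (1024 * q ^ 8)"
    proof (intro mult_le_mono power_mono n_le binomial_le_pow)
      have "5 \<le> q ^ 1" using q by simp
      also have "\<dots> \<le> q ^ 4" using q by (intro power_increasing) auto
      finally show "5 \<le> q ^ 4" .
    qed simp
    also have "\<dots> = 1024 * q ^ 48"
      by (simp add: power_mult[symmetric] power_add[symmetric])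
    finally have K: "(q ^ 4 choose 5) ^ 2 * n \<le> 1024 * q ^ 48" .
    have "real (1024 * q ^ 48 * 4 ^ q) < real (5 ^ q)"
      using Q0[OF q(1)] by (simp add: field_simps)
    then have "1024 * q ^ 48 * 4 ^ q < 5 ^ q"
      by (simp only: of_nat_less_iff)
    with mult_le_mono1[OF K, of "4 ^ q"] have "(q ^ 4 choose 5) ^ 2 * n * 4 ^ q < 5 ^ q"
      by (rule le_less_trans)
    then have ratio: "(q ^ 4 choose 5) ^ 2 * n * ((4 * q - 4) choose (q - 1)) < (4 * q - 4) choose (2 * q - 1)"
      using q by (intro choose_double_gt) auto
    have 3: "3 = (3 :: nat) ^ 1" "2 * (3 :: nat) - 1 = 5" "(3 :: nat) - 1 = 2"
      by simp_all
    show "\<exists>A B. A \<subseteq> {1..n} \<and> B \<subseteq> {1..n} \<and> card A = k \<and> card B = k \<and>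
      card (A \<inter> B) = k - r \<and> f A = f B"
    proof (rule johnson_monochromatic[OF q_def 3(1), where C = "{1..n}" and f = f and n = n and k = k
          and r = r and m = m and m' = m' and l = l and N = "4 * q - 4" and N' = "q ^ 4"], unfold 3(2,3))
      show "card {1..n} * (q ^ 4 choose 2) < q ^ 4 choose 5"
        using choose_5_gt[OF q(2) n_le] by simp
      show "(q ^ 4 choose 5) ^ 2 * card {1..n} * ((4 * q - 4) choose (q - 1)) < (4 * q - 4) choose (2 * q - 1)"
        using ratio by simp
    qed (use f m l in auto)
  qed
qed

section \<open>Reduction of the two conditions and the final comparison\<close>

text \<open>The equation becomes \<open>d\<^sup>2 = n - j * (n - 1)\<close>, and a square is
  nonnegative, so \<open>j\<close> is 0 or 1. If \<open>j = 0\<close>, then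
  \<open>(k - 2 * r)\<^sup>2 = r\<close>; if \<open>j = 1\<close>, then \<open>d\<close> is 1 or
  -1.\<close>

lemma johnson_parameters_of_tight_ratio:
  fixes n k r :: nat
  assumes eq: "r * (n - 1) = k * (n - k)" and k: "k \<le> n" and r: "0 < r" "n \<le> 4 * r" and n: "3 \<le> n"
  shows "4 * r - 1 \<le> n" "(int k - 2 * int r)\<^sup>2 \<le> int r"
proof -
  define d where "d = int n - 2 * int k"
  define j where "j = 4 * int r - int n"
  have eq': "int r * (int n - 1) = int k * (int n - int k)"
    using arg_cong[OF eq, of int] k n by simp
  have d2: "d\<^sup>2 = int n - j * (int n - 1)"
  proof -
    have "d\<^sup>2 = (int n)\<^sup>2 - 4 * (int k * (int n - int k))"
      by (simp add: d_def power2_eq_square algebra_simps)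
    also have "\<dots> = (int n)\<^sup>2 - 4 * (int r * (int n - 1))"
      unfolding eq' ..
    also have "\<dots> = int n - j * (int n - 1)"
      by (simp add: j_def power2_eq_square algebra_simps)
    finally show ?thesis .
  qed
  have "0 \<le> j"
    using r by (simp add: j_def)
  have "j < 2"
  proof (rule ccontr)
    assume "\<not> j < 2"
    then have "2 * (int n - 1) \<le> j * (int n - 1)"
      using n by (intro mult_right_mono) auto
    moreover have "int n < 2 * (int n - 1)"
      using n by simp
    ultimately have "d\<^sup>2 < 0"
      unfolding d2 by (simp only: less_iff_diff_less_0[symmetric] less_le_trans)
    then show False by simp
  qed
  then show "4 * r - 1 \<le> n"
    by (simp add: j_def)
  consider "j = 0" | "j = 1"
    using \<open>0 \<le> j\<close> \<open>j < 2\<close> by linarith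
  then show "(int k - 2 * int r)\<^sup>2 \<le> int r"
  proof cases
    case 1
    then have "d\<^sup>2 = 4 * (int k - 2 * int r)\<^sup>2" "int n = 4 * int r"
      by (auto simp: d_def j_def power2_eq_square algebra_simps)
    then show ?thesis
      using d2 1 by simp
  next
    case 2
    then have "d\<^sup>2 = 1"
      using d2 by simp
    then have "d = 1 \<or> d = -1"
      by (simp add: power2_eq_1_iff)
    then have "int k - 2 * int r = -1 \<or> int k - 2 * int r = 0"
      using 2 unfolding d_def j_def by linarith
    then show ?thesis
      using r by auto
  qed
qed

theorem theorem3:
  shows "\<exists>N :: nat. \<forall>n \<ge> N. \<forall>k r :: nat.
    n > 0 \<longrightarrow> k > 0 \<longrightarrow> r > 0 \<longrightarrow>
    1 \<le> r \<longrightarrow> r \<le> min k (n - k) \<longrightarrow>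
    (r * (n - 1) = k * (n - k) \<and> real r \<ge> real n / 4) \<or>
    (n = 4 * r \<and> r \<ge> 5 \<and>
      (\<exists>a :: int. 2 \<le> a \<and> real_of_int a \<le> sqrt (real r) \<and>
        (int k = 2 * int r - a \<or> int k = 2 * int r + a))) \<longrightarrow>
    quantum_chromatic_number (gen_johnson_graph n k (k - r))
      < chromatic_number (gen_johnson_graph n k (k - r))"
proof -
  obtain R where R: "\<forall>r\<ge>R. \<forall>n k. \<forall>f :: nat set \<Rightarrow> nat.
    4 * r - 1 \<le> n \<longrightarrow> n \<le> 4 * r \<longrightarrow> (int k - 2 * int r)\<^sup>2 \<le> int r \<longrightarrow>
    (\<forall>A. A \<subseteq> {1..n} \<and> card A = k \<longrightarrow> f A \<in> {1..n}) \<longrightarrow>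
    (\<exists>A B. A \<subseteq> {1..n} \<and> B \<subseteq> {1..n} \<and> card A = k \<and> card B = k \<and>
      card (A \<inter> B) = k - r \<and> f A = f B)"
    using johnson_monochromatic_of_large ..
  show ?thesis
  \<comment> \<open>The 3 serves the case analysis on \<open>j\<close>; since
    \<open>n \<le> 4 * r\<close>, the other bound yields \<open>R \<le> r\<close>.\<close>
  proof (intro exI[of _ "max 3 (4 * R)"] allI impI)
    fix n k r :: nat
    assume n: "max 3 (4 * R) \<le> n" and pos: "0 < r" and r: "r \<le> min k (n - k)"
      and cases: "(r * (n - 1) = k * (n - k) \<and> real r \<ge> real n / 4) \<or>
        (n = 4 * r \<and> r \<ge> 5 \<and>
          (\<exists>a :: int. 2 \<le> a \<and> real_of_int a \<le> sqrt (real r) \<and>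
            (int k = 2 * int r - a \<or> int k = 2 * int r + a)))"
    have "4 * r - 1 \<le> n \<and> n \<le> 4 * r \<and> (int k - 2 * int r)\<^sup>2 \<le> int r"
      using cases
    proof
      assume i: "r * (n - 1) = k * (n - k) \<and> real r \<ge> real n / 4"
      then have "n \<le> 4 * r" by linarith
      then show ?thesis
        using johnson_parameters_of_tight_ratio[of r n k] i n r pos by auto
    next
      assume "n = 4 * r \<and> r \<ge> 5 \<and> (\<exists>a :: int. 2 \<le> a \<and> real_of_int a \<le> sqrt (real r) \<and>
        (int k = 2 * int r - a \<or> int k = 2 * int r + a))"
      then obtain a :: int where a: "n = 4 * r" "2 \<le> a" "real_of_int a \<le> sqrt (real r)"
        "int k = 2 * int r - a \<or> int k = 2 * int r + a" by blast
      then have "(real_of_int a)\<^sup>2 \<le> (sqrt (real r))\<^sup>2"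
        by (intro power_mono) auto
      then have "real_of_int (a\<^sup>2) \<le> real_of_int (int r)"
        by simp
      then have "a\<^sup>2 \<le> int r"
        by (simp only: of_int_le_iff)
      moreover have "(int k - 2 * int r)\<^sup>2 = a\<^sup>2"
        using a(4) by auto
      ultimately show ?thesis
        using a(1) by simp
    qed
    then have par: "4 * r - 1 \<le> n" "n \<le> 4 * r" "(int k - 2 * int r)\<^sup>2 \<le> int r"
      by auto
    define G where "G = gen_johnson_graph n k (k - r)"
    have "n < chromatic_number G"
    proof (rule ccontr)
      assume le: "\<not> n < chromatic_number G"
      have "\<exists>f. proper_coloring G (chromatic_number G) f"
        unfolding G_def by (rule chromatic_number_attained[OF pair_graph_gen_johnson_graph])
      then obtain f where f: "proper_coloring G (chromatic_number G) f" ..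
      have fn: "f A \<in> {1..n}" if "A \<subseteq> {1..n} \<and> card A = k" for A
      proof -
        have "A \<in> pverts G"
          using that by (simp add: G_def gen_johnson_graph_def)
        then have "f A \<in> {1..chromatic_number G}"
          using f unfolding proper_coloring_def by blast
        then show ?thesis
          using le by simp
      qed
      have "\<exists>A B. A \<subseteq> {1..n} \<and> B \<subseteq> {1..n} \<and> card A = k \<and> card B = k \<and>
          card (A \<inter> B) = k - r \<and> f A = f B"
      proof (rule R[rule_format])
        show "R \<le> r" using par n by simp
      qed (fact par fn)+
      then obtain A B where AB: "A \<subseteq> {1..n}" "B \<subseteq> {1..n}" "card A = k" "card B = k"
          "card (A \<inter> B) = k - r" "f A = f B"
        by blast
      \<comment> \<open>Equal sets would meet in \<open>k\<close> points, but
        \<open>k - r < k\<close> because \<open>0 < r \<le> k\<close>.\<close>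
      moreover have "A \<noteq> B"
        using AB r pos by auto
      ultimately have "(A, B) \<in> parcs G"
        by (simp add: G_def gen_johnson_graph_def)
      then show False
        using f AB(6) by (auto simp: proper_coloring_def)
    qed
    moreover have "quantum_chromatic_number G \<le> n"
      unfolding G_def using pos r par n by (intro quantum_chromatic_number_johnson_le) auto
    ultimately show "quantum_chromatic_number (gen_johnson_graph n k (k - r))
        < chromatic_number (gen_johnson_graph n k (k - r))"
      unfolding G_def by simp
  qed
qed

end
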